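(* For each approval-based election $E$ with $m\ge k$ candidates and committee size $k$ (and every arrival order of the candidates), the Online Greedy Cohesive Algorithm (OGCA) returns a committee $W$ of size $k$ that satisfies $\mathrm{H}(k)$-EJR, where $\mathrm{H}(k)=\sum_{j=1}^k 1/j$.
   Context: An approval-based election consists of a finite set $C$ of $m$ candidates, a set $N=\{1,\dots,n\}$ of voters, a committee size $k$ with $1\le k\le m$, and for each voter $i\in N$ a set $A(i)\subseteq C$ of approved candidates. $N(c)=\{i\in N: c\in A(i)\}$. In the online setting the candidates arrive in a sequence $c_1,\dots,c_m$; when $c_t$ arrives, $N(c_t)$ is revealed, and one must decide immediately and irrevocably whether to select $c_t$, without knowing $N(c_{t'})$ for $t'>t$ (while $n,k,m$ are known). For a real $\alpha\ge 1$ and $\ell\in\{1,\dots,k\}$, a group $S\subseteq N$ is $\alpha$-$\ell$-cohesive if $|S|\ge \alpha\cdot\ell\cdot n/k$ and $\left|\bigcap_{i\in S}A(i)\right|\ge \ell$. A committee $W\subseteq C$ satisfies $\alpha$-EJR ($\alpha$-extended justified representation) if for each $\ell\in\{1,\dots,k\}$ and each $\alpha$-$\ell$-cohesive group $S$ there is a voter $i\in S$ with $|A(i)\cap W|\ge \ell$. OGCA: when a candidate $c$ arrives, if there exist $\ell\in\{1,\dots,k\}$ and a group of voters $S\subseteq N(c)$ with $|S|\ge \mathrm{H}(k)\cdot \ell\cdot n/k$ such that each voter in $S$ approves fewer than $\ell$ of the candidates selected so far, then $c$ is selected; otherwise $c$ is rejected. If the rule were to select fewer than $k$ candidates, the candidates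 that arrive last are accepted so that the committee seats are filled (i.e., as soon as the number of candidates still to be decided on, including the current one, equals the number of unfilled seats, all of them are selected). *)

theory Defs
  imports Complex_Main "HOL-Analysis.Harmonic_Numbers"
begin

text \<open>
  Voters are the numbers \<open>1, \<dots>, n\<close>. There must be at least one: for \<open>n = 0\<close> the empty
  group would be cohesive, and no committee could satisfy the axiom below.
\<close>

definition election :: "'c set \<Rightarrow> nat \<Rightarrow> nat \<Rightarrow> (nat \<Rightarrow> 'c set) \<Rightarrow> bool" where
  "election C n k A \<longleftrightarrow>
     finite C \<and> 1 \<le> n \<and> 1 \<le> k \<and> k \<le> card C \<and> (\<forall>i\<in>{1..n}. A i \<subseteq> C)"

definition supporters :: "nat \<Rightarrow> (nat \<Rightarrow> 'c set) \<Rightarrow> 'c \<Rightarrow> nat set" where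
  "supporters n A c = {i \<in> {1..n}. c \<in> A i}"

definition cohesive ::
  "nat \<Rightarrow> nat \<Rightarrow> (nat \<Rightarrow> 'c set) \<Rightarrow> real \<Rightarrow> nat \<Rightarrow> nat set \<Rightarrow> bool" where
  "cohesive n k A \<alpha> l S \<longleftrightarrow>
     S \<subseteq> {1..n} \<and> real (card S) \<ge> \<alpha> * real l * real n / real k \<and> card (\<Inter>i\<in>S. A i) \<ge> l"

definition EJR :: "nat \<Rightarrow> nat \<Rightarrow> (nat \<Rightarrow> 'c set) \<Rightarrow> real \<Rightarrow> 'c set \<Rightarrow> bool" where
  "EJR n k A \<alpha> W \<longleftrightarrow>
     (\<forall>l\<in>{1..k}. \<forall>S. cohesive n k A \<alpha> l S \<longrightarrow> (\<exists>i\<in>S. card (A i \<inter> W) \<ge> l))"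

definition ogca_greedy :: "nat \<Rightarrow> nat \<Rightarrow> (nat \<Rightarrow> 'c set) \<Rightarrow> 'c set \<Rightarrow> 'c \<Rightarrow> bool" where
  "ogca_greedy n k A W c \<longleftrightarrow>
     (\<exists>l\<in>{1..k}. \<exists>S \<subseteq> supporters n A c.
        real (card S) \<ge> harm k * real l * real n / real k \<and> (\<forall>i\<in>S. card (A i \<inter> W) < l))"

text \<open>
  \<open>ogca_from n k A W cs\<close> continues the rule when \<open>W\<close> has been selected so far and the
  candidates \<open>cs\<close> are still to arrive, in this order. The second disjunct says that the number
  of undecided candidates, including the current one, equals the number of unfilled seats.
  Nothing in the rule stops the greedy test from selecting more than \<open>k\<close> candidates.
  A decision looks at the list of later candidates only through its length, and at the ballots
  only through the current candidate and those already selected.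
\<close>

primrec ogca_from ::
  "nat \<Rightarrow> nat \<Rightarrow> (nat \<Rightarrow> 'c set) \<Rightarrow> 'c set \<Rightarrow> 'c list \<Rightarrow> 'c set" where
  "ogca_from n k A W [] = W"
| "ogca_from n k A W (c # cs) =
     (if ogca_greedy n k A W c \<or> card W + length (c # cs) = k
      then ogca_from n k A (insert c W) cs
      else ogca_from n k A W cs)"

definition OGCA :: "nat \<Rightarrow> nat \<Rightarrow> (nat \<Rightarrow> 'c set) \<Rightarrow> 'c list \<Rightarrow> 'c set" where
  "OGCA n k A cs = ogca_from n k A {} cs"

end

theory Submission
  imports Defs
begin

text \<open>
  Give voter \<open>i\<close> the potential \<open>H(|A(i) \<inter> W|)\<close>, capped at \<open>H(k)\<close>. A greedy selection witnessed
  by \<open>\<ell>\<close> and \<open>S\<close> raises the potential of each voter in \<open>S\<close> by at least \<open>1/\<ell>\<close>, hence the total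
  by at least \<open>|S|/\<ell> \<ge> H(k) n/k\<close>. As the total never exceeds \<open>n H(k)\<close>, there are at most \<open>k\<close>
  greedy selections, and the final fill-up makes the size exactly \<open>k\<close>. A group violating EJR
  would jointly approve a rejected candidate, but it would have triggered the greedy test when
  that candidate arrived, since voters only gain representatives over time.
\<close>

definition potential :: "nat \<Rightarrow> nat \<Rightarrow> (nat \<Rightarrow> 'c set) \<Rightarrow> 'c set \<Rightarrow> real" where
  "potential n k A W = (\<Sum>i\<in>{1..n}. harm (min (card (A i \<inter> W)) k))"

text \<open>The cap yields this for every \<open>W\<close>. Uncapped, the bound would presuppose the
  limit on the committee size that is still to be proved.\<close>

lemma potential_le: "potential n k A W \<le> real n * harm k"
proof -
  have "potential n k A W \<le> (\<Sum>i\<in>{1..n}. harm k)"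
    unfolding potential_def by (intro sum_mono harm_mono) simp
  then show ?thesis by simp
qed

lemma potential_insert_greedy:
  assumes "finite W" "c \<notin> W" "ogca_greedy n k A W c"
  shows "potential n k A W + harm k * real n / real k \<le> potential n k A (insert c W)"
proof -
  obtain l S where l: "1 \<le> l" "l \<le> k" and S: "S \<subseteq> supporters n A c"
    and big: "harm k * real l * real n / real k \<le> real (card S)"
    and few: "\<And>i. i \<in> S \<Longrightarrow> card (A i \<inter> W) < l"
    using assms(3) unfolding ogca_greedy_def by auto
  have SN: "S \<subseteq> {1..n}" using S by (auto simp: supporters_def)
  let ?h = "\<lambda>W i. harm (min (card (A i \<inter> W)) k) :: real"
  have gain: "?h W i + (if i \<in> S then 1 / real l else 0) \<le> ?h (insert c W) i" for i
  proof (cases "i \<in> S")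
    case True
    then have "c \<in> A i" using S by (auto simp: supporters_def)
    then have "card (A i \<inter> insert c W) = Suc (card (A i \<inter> W))"
      using assms by simp
    moreover have "1 / real l \<le> 1 / real (Suc (card (A i \<inter> W)))"
      using few[OF True] by (intro divide_left_mono) auto
    \<comment> \<open>As \<open>card (A i \<inter> W) < l\<close> and \<open>l \<le> k\<close>, the
      cap is inactive both before and after the insertion.\<close>
    ultimately show ?thesis
      using True few[OF True] l by (simp add: min_def harm_Suc inverse_eq_divide)
  next
    case False
    have "card (A i \<inter> W) \<le> card (A i \<inter> insert c W)"
      using assms(1) by (intro card_mono) auto
    then show ?thesis using False by (auto intro!: harm_mono)
  qed
  have "harm k * real n / real k \<le> real (card S) / real l"
    using big l by (simp add: field_simps)
  also have "\<dots> = (\<Sum>i\<in>{1..n}. if i \<in> S then 1 / real l else 0)"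
    using SN by (simp add: sum.If_cases Int_absorb1)
  finally have "potential n k A W + harm k * real n / real k
      \<le> (\<Sum>i\<in>{1..n}. ?h W i + (if i \<in> S then 1 / real l else 0))"
    by (simp add: potential_def sum.distrib)
  also have "\<dots> \<le> potential n k A (insert c W)"
    unfolding potential_def by (intro sum_mono gain)
  finally show ?thesis .
qed

text \<open>Each selection fills one seat and uses up one candidate, so the equality that triggers
  the fill-up persists to the end.\<close>

lemma ogca_from_fill:
  assumes "finite W" "distinct cs" "set cs \<inter> W = {}" "card W + length cs = k"
  shows "ogca_from n k A W cs = W \<union> set cs"
  using assms by (induction cs arbitrary: W) auto

text \<open>The last hypothesis is the invariant that every member of \<open>W\<close> has raised
  the potential by \<open>harm k * n / k\<close> on average. It holds as long as all selections are
  greedy, and at the end of the list it forces \<open>card W \<le> k\<close>.\<close>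

lemma card_ogca_from:
  assumes "1 \<le> n" "1 \<le> k"
    and "finite W" "distinct cs" "set cs \<inter> W = {}" "k \<le> card W + length cs"
    and "real (card W) * (harm k * real n / real k) \<le> potential n k A W"
  shows "card (ogca_from n k A W cs) = k"
  using assms(3-)
proof (induction cs arbitrary: W)
  case Nil
  have "harm k > (0::real)" using assms by (intro harm_pos) simp
  moreover have "real (card W) * (harm k * real n / real k) \<le> real n * harm k"
    using Nil.prems potential_le[of n k A W] by simp
  ultimately have "card W \<le> k" using assms by (simp add: field_simps)
  then show ?case using Nil by simp
next
  case (Cons c cs)
  show ?case
  \<comment> \<open>Once the fill-up starts, the outcome is known at once, so the invariant need not
    survive selections that are not greedy.\<close>
  proof (cases "card W + length (c # cs) = k")
    case True
    then have "ogca_from n k A W (c # cs) = W \<union> set (c # cs)"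
      using Cons.prems by (intro ogca_from_fill) auto
    moreover have "card (W \<union> set (c # cs)) = k"
      using Cons.prems True by (subst card_Un_disjoint) (auto simp: distinct_card)
    ultimately show ?thesis by simp
  next
    case False
    show ?thesis
    proof (cases "ogca_greedy n k A W c")
      case True
      have "real (card (insert c W)) * (harm k * real n / real k)
          = real (card W) * (harm k * real n / real k) + harm k * real n / real k"
        using Cons.prems by (simp add: algebra_simps add_divide_distrib)
      then have "real (card (insert c W)) * (harm k * real n / real k)
          \<le> potential n k A (insert c W)"
        using potential_insert_greedy[of W c n k A] Cons.prems True by simp
      then have "card (ogca_from n k A (insert c W) cs) = k"
        using Cons.prems by (intro Cons.IH) auto
      then show ?thesis using True by simp
    next
      case nogreedy: False
      \<comment> \<open>Without equality, more candidates than open seats remain, so one can be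
        rejected.\<close>
      then show ?thesis using Cons False by simp
    qed
  qed
qed

lemma ogca_from_bounds: "W \<subseteq> ogca_from n k A W cs" "ogca_from n k A W cs \<subseteq> W \<union> set cs"
  by (induction cs arbitrary: W) (auto, blast+)

lemma ogca_greedy_antimono:
  assumes "ogca_greedy n k A V c" "W \<subseteq> V" "finite V"
  shows "ogca_greedy n k A W c"
proof -
  have "card (A i \<inter> W) \<le> card (A i \<inter> V)" for i
    using assms by (intro card_mono) auto
  then show ?thesis
    using assms(1) unfolding ogca_greedy_def by (meson le_less_trans)
qed

text \<open>A group passing the test against the final committee also passes it against the smaller
  one at the arrival of \<open>c\<close>. This leaves EJR to be derived from the final committee
  alone.\<close>

lemma ogca_from_closed:
  assumes "finite W" "c \<in> set cs" "ogca_greedy n k A (ogca_from n k A W cs) c"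
  shows "c \<in> ogca_from n k A W cs"
  using assms
proof (induction cs arbitrary: W)
  case (Cons d cs)
  show ?case
  proof (cases "c = d")
    case True
    have "finite (ogca_from n k A W (d # cs))"
      using Cons.prems(1) by (intro finite_subset[OF ogca_from_bounds(2)]) simp
    then have "ogca_greedy n k A W c"
      using Cons.prems(3) ogca_from_bounds(1) by (rule ogca_greedy_antimono[rotated -1])
    then show ?thesis
      using True ogca_from_bounds(1)[of "insert d W" n k A cs] by auto
  next
    case False
    then show ?thesis using Cons by (auto split: if_splits)
  qed
qed simp

lemma EJR_if_greedy_closed:
  assumes el: "election C n k A" and W: "finite W"
    and closed: "\<And>c. c \<in> C \<Longrightarrow> ogca_greedy n k A W c \<Longrightarrow> c \<in> W"
  shows "EJR n k A (harm k) W"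
  unfolding EJR_def
proof (intro ballI allI impI)
  fix l S assume l: "l \<in> {1..k}" and coh: "cohesive n k A (harm k) l S"
  show "\<exists>i\<in>S. l \<le> card (A i \<inter> W)"
  proof (rule ccontr)
    assume "\<not> ?thesis"
    then have few: "\<forall>i\<in>S. card (A i \<inter> W) < l" by auto
    have big: "harm k * real l * real n / real k \<le> real (card S)"
      and SN: "S \<subseteq> {1..n}" and common: "l \<le> card (\<Inter>i\<in>S. A i)"
      using coh by (auto simp: cohesive_def)
    \<comment> \<open>A member of \<open>S\<close> is needed both to place the common candidates in
      \<open>C\<close> and to reach the contradiction.\<close>
    have "0 < harm k * real l * real n / real k"
      using el l by (simp add: election_def harm_pos)
    then have "S \<noteq> {}" using big by auto
    then obtain i where i: "i \<in> S" by blast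
    have "(\<Inter>i\<in>S. A i) \<subseteq> W"
    proof
      fix c assume c: "c \<in> (\<Inter>i\<in>S. A i)"
      have "c \<in> C" using c i SN el by (auto simp: election_def)
      moreover have "S \<subseteq> supporters n A c" using c SN by (auto simp: supporters_def)
      then have "ogca_greedy n k A W c"
        unfolding ogca_greedy_def using l big few by blast
      ultimately show "c \<in> W" by (rule closed)
    qed
    then have "card (\<Inter>i\<in>S. A i) \<le> card (A i \<inter> W)"
      using i W by (intro card_mono) auto
    then show False using few i common by force
  qed
qed

theorem theorem5p2:
  fixes C :: "'c set" and n k :: nat and A :: "nat \<Rightarrow> 'c set" and cs :: "'c list"
  assumes "election C n k A"
    and "distinct cs" and "set cs = C"
  shows "OGCA n k A cs \<subseteq> C \<and> card (OGCA n k A cs) = k \<and> EJR n k A (harm k) (OGCA n k A cs)"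
proof -
  have sub: "OGCA n k A cs \<subseteq> C"
    using ogca_from_bounds(2)[of n k A "{}" cs] assms(3) by (simp add: OGCA_def)
  have "length cs = card C" using assms by (metis distinct_card)
  then have "card (OGCA n k A cs) = k"
    using assms unfolding OGCA_def
    \<comment> \<open>For the empty committee, both sides of the invariant are 0.\<close>
    by (intro card_ogca_from) (auto simp: election_def potential_def harm_expand)
  moreover have "finite (OGCA n k A cs)"
    using sub assms(1) finite_subset by (auto simp: election_def)
  then have "EJR n k A (harm k) (OGCA n k A cs)"
    using assms ogca_from_closed[of "{}" _ cs n k A]
    by (intro EJR_if_greedy_closed[of C]) (auto simp: OGCA_def)
  ultimately show ?thesis using sub by blast
qed

end
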